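(* Let $n \ge 1$ be an integer such that $n+1$ is prime. Then the ladder $P_n \times P_2$ has a prime labeling. Moreover, such a prime labeling is realized by giving the top row vertices $v_1, v_2, \ldots, v_n$ (left to right) the labels $1, 2, \ldots, n$, and giving the bottom row vertices $u_1, u_2, \ldots, u_n$ (left to right) the labels $n+2, n+3, \ldots, 2n, n+1$; that is, $v_i$ receives label $i$ for $1 \le i \le n$, $u_i$ receives label $n+1+i$ for $1 \le i \le n-1$, and $u_n$ receives label $n+1$.
   Context: The ladder $P_n \times P_2$ is the simple graph with $2n$ vertices $v_1, \ldots, v_n$ (top row, left to right) and $u_1, \ldots, u_n$ (bottom row, left to right), whose edges are $v_i u_i$ for $1 \le i \le n$, and $v_i v_{i+1}$, $u_i u_{i+1}$ for $1 \le i \le n-1$. A prime labeling of a simple graph with $N$ vertices is a bijection from its vertex set to $\{1, 2, \ldots, N\}$ such that the labels of any two adjacent vertices are relatively prime. *)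

theory Defs
  imports "Graph_Theory.Pair_Digraph" "HOL-Computational_Algebra.Primes"
begin

text \<open>
  A finite simple graph is a \<open>pair_graph\<close>: a finite, loop-free, symmetric digraph whose
  arcs are ordered pairs of vertices, so that each undirected edge appears as two arcs.
\<close>

definition prime_labeling :: "'a pair_pre_digraph \<Rightarrow> ('a \<Rightarrow> nat) \<Rightarrow> bool" where
  "prime_labeling G f \<longleftrightarrow>
     bij_betw f (pverts G) {1..card (pverts G)} \<and>
     (\<forall>x y. (x, y) \<in> parcs G \<longrightarrow> coprime (f x) (f y))"

datatype ladder_vertex = V nat | U nat

text \<open>Each edge in one orientation; \<open>ladder\<close> adds the reverse arcs.\<close>

definition ladder_edges :: "nat \<Rightarrow> (ladder_vertex \<times> ladder_vertex) set" where
  "ladder_edges n =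
     {(V i, U i) | i. 1 \<le> i \<and> i \<le> n} \<union>
     {(V i, V (i + 1)) | i. 1 \<le> i \<and> i < n} \<union>
     {(U i, U (i + 1)) | i. 1 \<le> i \<and> i < n}"

definition ladder :: "nat \<Rightarrow> ladder_vertex pair_pre_digraph" where
  "ladder n = \<lparr> pverts = V ` {1..n} \<union> U ` {1..n},
                parcs = ladder_edges n \<union> converse (ladder_edges n) \<rparr>"

lemma card_pverts_ladder: "card (pverts (ladder n)) = 2 * n"
proof -
  have "card (V ` {1..n} \<union> U ` {1..n}) = card (V ` {1..n}) + card (U ` {1..n})"
    by (rule card_Un_disjoint) auto
  also have "\<dots> = 2 * n"
    by (simp add: card_image inj_on_def)
  finally show ?thesis
    by (simp add: ladder_def)
qed

lemma pair_graph_ladder: "pair_graph (ladder n)"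
proof -
  have sub: "parcs (ladder n) \<subseteq> pverts (ladder n) \<times> pverts (ladder n)"
    by (auto simp: ladder_def ladder_edges_def)
  have fin: "finite (pverts (ladder n))"
    by (simp add: ladder_def)
  have "sym (parcs (ladder n))"
    by (auto simp: ladder_def sym_def)
  moreover have "arcs_ends (with_proj (ladder n)) = parcs (ladder n)"
    by (auto simp: arcs_ends_conv)
  ultimately have symm: "symmetric (with_proj (ladder n))"
    by (simp add: symmetric_def)
  show ?thesis
  proof unfold_locales
    show "finite (parcs (ladder n))"
      using fin sub by (meson finite_SigmaI finite_subset)
    show "fst e \<noteq> snd e" if "e \<in> parcs (ladder n)" for e
      using that by (auto simp: ladder_def ladder_edges_def)
  qed (use sub fin symm in auto)
qed

end

theory Submission
  imports Defs
begin

text \<open>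
  Write \<open>p = n + 1\<close>. The bottom labels are \<open>p + 1, \<dots>, 2 p - 2, p\<close>, so both rows together use each
  number in \<open>{1..2 n}\<close> once. Horizontal edges, apart from the last one of the bottom row, and
  the last rung, join consecutive integers. The rung at a column \<open>i < n\<close> joins \<open>i\<close> to \<open>p + i\<close>,
  which are coprime because a prime has no common factor with a smaller positive integer. The only
  other edge joins \<open>2 n\<close> to \<open>p\<close> and occurs only for \<open>n \<ge> 2\<close>; there \<open>2 n\<close> lies strictly between
  \<open>p\<close> and \<open>2 p\<close>, so the prime \<open>p\<close> does not divide it.
\<close>

definition ladder_label :: "nat \<Rightarrow> ladder_vertex \<Rightarrow> nat" where
  "ladder_label n x = (case x of V i \<Rightarrow> i | U i \<Rightarrow> if i = n then n + 1 else n + 1 + i)"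

text \<open>
  Surjectivity needs no explicit preimages: the labels are distinct and stay within the range,
  and there are as many vertices as numbers in the range.
\<close>

lemma bij_betw_ladder_label:
  assumes "n \<ge> 1"
  shows "bij_betw (ladder_label n) (pverts (ladder n)) {1..2 * n}"
  unfolding bij_betw_def
proof
  show inj: "inj_on (ladder_label n) (pverts (ladder n))"
    by (auto simp: inj_on_def ladder_def ladder_label_def split: if_splits)
  have sub: "ladder_label n ` pverts (ladder n) \<subseteq> {1..2 * n}"
    using assms by (auto simp: ladder_def ladder_label_def)
  have "card (ladder_label n ` pverts (ladder n)) = card {1..2 * n}"
    by (simp add: card_image[OF inj] card_pverts_ladder)
  with sub show "ladder_label n ` pverts (ladder n) = {1..2 * n}"
    by (intro card_subset_eq) auto
qed

lemma coprime_add_prime: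
  fixes p i :: nat
  assumes "prime p" "0 < i" "i < p"
  shows "coprime i (p + i)"
proof -
  have "\<not> p dvd i"
    using assms by (auto dest: dvd_imp_le)
  then have "coprime p i"
    using assms(1) by (rule prime_imp_coprime[rotated])
  then show ?thesis
    using gcd_add1[of p i] unfolding coprime_iff_gcd_eq_1 by (simp only: gcd.commute)
qed

lemma coprime_prime_between_multiples:
  fixes p k :: nat
  assumes "prime p" "p < k" "k < 2 * p"
  shows "coprime k p"
proof -
  have "\<not> p dvd k"
  proof
    assume "p dvd k"
    then have "p dvd k - p"
      by (simp add: dvd_diff_nat)
    then show False
      using assms by (auto dest: dvd_imp_le)
  qed
  then show ?thesis
    using assms(1) prime_imp_coprime coprime_commute by blast
qed

text \<open>
  One orientation of each edge is enough, since coprimality is symmetric. Primality of \<open>n + 1\<close>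
  enters for the rungs other than the last and for the last edge of the bottom row; every other
  pair of labels is consecutive.
\<close>

lemma coprime_ladder_label:
  assumes "prime (n + 1)" "(x, y) \<in> ladder_edges n"
  shows "coprime (ladder_label n x) (ladder_label n y)"
proof -
  consider
      (rung) i where "x = V i" "y = U i" "1 \<le> i" "i \<le> n"
    | (top) i where "x = V i" "y = V (i + 1)"
    | (bottom) i where "x = U i" "y = U (i + 1)" "1 \<le> i" "i < n"
    using assms(2) by (auto simp: ladder_edges_def)
  then show ?thesis
  proof cases
    case rung
    show ?thesis
    proof (cases "i = n")
      case True
      with rung show ?thesis by (simp add: ladder_label_def)
    next
      case False
      with rung coprime_add_prime[OF assms(1), of i] show ?thesis
        by (simp add: ladder_label_def)
    qed
  next
    case top
    then show ?thesis by (simp add: ladder_label_def)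
  next
    case bottom
    show ?thesis
    proof (cases "i + 1 = n")
      case True
      with bottom have "ladder_label n x = 2 * n" "ladder_label n y = n + 1" "n \<ge> 2"
        by (auto simp: ladder_label_def)
      with coprime_prime_between_multiples[OF assms(1), of "2 * n"] show ?thesis
        by simp
    next
      case False
      with bottom have "ladder_label n y = Suc (ladder_label n x)"
        by (simp add: ladder_label_def)
      then show ?thesis by simp
    qed
  qed
qed

theorem theorem1:
  fixes n :: nat
  assumes "n \<ge> 1" and "prime (n + 1)"
  shows "(\<exists>f. prime_labeling (ladder n) f) \<and>
         prime_labeling (ladder n)
           (\<lambda>x. case x of V i \<Rightarrow> i | U i \<Rightarrow> if i = n then n + 1 else n + 1 + i)"
proof -
  have "coprime (ladder_label n x) (ladder_label n y)" if "(x, y) \<in> parcs (ladder n)" for x y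
  proof -
    from that have "(x, y) \<in> ladder_edges n \<or> (y, x) \<in> ladder_edges n"
      by (auto simp: ladder_def)
    then show ?thesis
      using coprime_ladder_label[OF assms(2)] coprime_commute by blast
  qed
  then have "prime_labeling (ladder n) (ladder_label n)"
    using bij_betw_ladder_label[OF assms(1)]
    by (simp add: prime_labeling_def card_pverts_ladder)
  moreover have "ladder_label n =
      (\<lambda>x. case x of V i \<Rightarrow> i | U i \<Rightarrow> if i = n then n + 1 else n + 1 + i)"
    by (simp add: ladder_label_def fun_eq_iff)
  ultimately show ?thesis by auto
qed

end
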